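(* For all $n\geq 2$, $AR_{FF}(K_n) = \frac{n^3}{6}(1+o(1))$, where $K_n$ is the complete graph on $n$ vertices and $o(1)$ is a function of $n$ tending to $0$ as $n\to\infty$.
   Context: All graphs are finite and simple. An edge-colored graph is rainbow if all its edges have distinct colors. A copy of $H$ is a (not necessarily induced) subgraph isomorphic to $H$. $AR_{FF}(H)$ (First-Fit anti-Ramsey number): Builder presents vertices and edges of a simple graph, one edge at a time, and each new edge is immediately colored by Painter with the smallest color in $\{1,2,\ldots\}$ not used on an adjacent edge already presented (First-Fit). $AR_{FF}(H)$ is the smallest $t$ such that Builder can present $t$ edges so that the resulting colored graph contains a rainbow copy of $H$. *)

theory Defs
  imports Complex_Main "HOL-Library.Extended_Real"
begin

type_synonym 'a graph = "'a set \<times> 'a set set"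

abbreviation verts :: "'a graph \<Rightarrow> 'a set" where
  "verts G \<equiv> fst G"

abbreviation edges :: "'a graph \<Rightarrow> 'a set set" where
  "edges G \<equiv> snd G"

definition simple_graph :: "'a graph \<Rightarrow> bool" where
  "simple_graph G \<longleftrightarrow> finite (verts G) \<and> (\<forall>e\<in>edges G. e \<subseteq> verts G \<and> card e = 2)"

definition subgraph :: "'a graph \<Rightarrow> 'a graph \<Rightarrow> bool" where
  "subgraph F G \<longleftrightarrow> simple_graph F \<and> verts F \<subseteq> verts G \<and> edges F \<subseteq> edges G"

definition isomorphic :: "'a graph \<Rightarrow> 'b graph \<Rightarrow> bool" where
  "isomorphic F H \<longleftrightarrow>
     (\<exists>f. bij_betw f (verts F) (verts H) \<and> edges H = (\<lambda>e. f ` e) ` edges F)"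

definition complete_graph :: "nat \<Rightarrow> nat graph" where
  "complete_graph n = ({..<n}, {e. e \<subseteq> {..<n} \<and> card e = 2})"

text \<open>A partial edge coloring is a map whose domain is the set of edges presented so far.
  Colors are positive.\<close>

definition first_fit_step :: "'a set \<Rightarrow> ('a set \<rightharpoonup> nat) \<Rightarrow> ('a set \<rightharpoonup> nat)" where
  "first_fit_step e c =
     c(e \<mapsto> (LEAST k. 1 \<le> k \<and> (\<forall>f\<in>dom c. f \<inter> e \<noteq> {} \<longrightarrow> c f \<noteq> Some k)))"

definition first_fit :: "'a set list \<Rightarrow> ('a set \<rightharpoonup> nat)" where
  "first_fit es = fold first_fit_step es Map.empty"

definition presentation :: "'a set \<Rightarrow> 'a set list \<Rightarrow> bool" where
  "presentation V es \<longleftrightarrow> simple_graph (V, set es) \<and> distinct es"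

definition has_rainbow_copy :: "('a set \<rightharpoonup> nat) \<Rightarrow> 'a graph \<Rightarrow> 'b graph \<Rightarrow> bool" where
  "has_rainbow_copy c G H \<longleftrightarrow>
     (\<exists>F. subgraph F G \<and> isomorphic F H \<and> inj_on c (edges F))"

text \<open>Painter is deterministic, so a strategy of Builder amounts to a fixed finite sequence of
  edges; its vertices may be taken to be natural numbers. The infimum in \<^typ>\<open>enat\<close> is a minimum
  whenever Builder can force a rainbow copy at all, and \<open>\<infinity>\<close> otherwise.\<close>

definition AR_FF :: "'b graph \<Rightarrow> enat" where
  "AR_FF H = Inf {enat (length es) | (V :: nat set) es.
     presentation V es \<and> has_rainbow_copy (first_fit es) (V, set es) H}"

end

theory Submission imports Defs "HOL-Library.Nat_Bijection" "HOL-Real_Asymp.Real_Asymp" begin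

text \<open>
  The argument gives $\binom n3 \le AR_{FF}(K_n) \le \binom{n+1}3$.

  Lower bound: let \<open>W\<close> be the vertex set of a rainbow copy of \<open>K\<^sub>n\<close>. Since Painter plays First-Fit,
  an edge of the copy joining two vertices that both miss color \<open>k\<close> has a color below \<open>k\<close>. So if \<open>s\<close>
  vertices of \<open>W\<close> miss \<open>k\<close>, then $\binom s2 < k$. The other \<open>n - s\<close> vertices of \<open>W\<close> are covered by
  edges of color \<open>k\<close>, only one of which can lie inside \<open>W\<close>; so there are at least \<open>n - s - 1\<close> such
  edges. Summing over $k \le \binom n2$ gives $\binom n3$.

  Upper bound: for \<open>j = 0, \<dots>, n - 1\<close> Builder attaches $\binom j2$ pendant edges to \<open>j\<close>, which get
  colors $1, \dots, \binom j2$, and then joins \<open>j\<close> to \<open>0, \<dots>, j - 1\<close>; these edges get colors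
  $\binom j2 + 1, \dots, \binom{j+1}2$, because all colors at the earlier vertices are at most
  $\binom j2$.
\<close>

section \<open>Lower bound\<close>

lemma dom_first_fit: "dom (first_fit es) = set es"
  by (induction es rule: rev_induct) (simp_all add: first_fit_def first_fit_step_def del: fun_upd_apply)

lemma first_fit_snoc: "first_fit (es @ [e]) = first_fit_step e (first_fit es)"
  by (simp add: first_fit_def)

lemma first_fit_free_color:
  fixes c :: "'a set \<rightharpoonup> nat"
  assumes "finite (dom c)"
  shows "\<exists>k\<ge>1. \<forall>f\<in>dom c. f \<inter> e \<noteq> {} \<longrightarrow> c f \<noteq> Some k"
proof -
  have "finite (insert 0 (ran c))" using assms by (simp add: finite_ran)
  then obtain k where "k \<notin> insert 0 (ran c)" using ex_new_if_finite[OF infinite_UNIV_nat] by metis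
  then show ?thesis by (intro exI[of _ k]) (auto simp: ran_def)
qed

text \<open>When an edge is presented, minimality of its color gives a blocking edge for each
  smaller color. As \<open>es\<close> is distinct, no edge is ever recolored, so the blocking edges
  keep their colors to the end.\<close>

lemma first_fit_color:
  assumes "distinct es" "first_fit es e = Some k"
  shows "k \<ge> 1"
    and "\<And>l. \<lbrakk>1 \<le> l; l < k\<rbrakk> \<Longrightarrow> \<exists>f\<in>set es. f \<inter> e \<noteq> {} \<and> first_fit es f = Some l"
proof -
  have "k \<ge> 1 \<and> (\<forall>l. 1 \<le> l \<and> l < k \<longrightarrow> (\<exists>f\<in>set es. f \<inter> e \<noteq> {} \<and> first_fit es f = Some l))"
    using assms
  proof (induction es rule: rev_induct)
    case Nil
    then show ?case by (simp add: first_fit_def)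
  next
    case (snoc a es)
    let ?c = "first_fit es"
    let ?P = "\<lambda>k. 1 \<le> k \<and> (\<forall>f\<in>dom ?c. f \<inter> a \<noteq> {} \<longrightarrow> ?c f \<noteq> Some k)"
    have new: "first_fit (es @ [a]) = ?c(a \<mapsto> (LEAST k. ?P k))"
      unfolding first_fit_snoc first_fit_step_def ..
    have old: "first_fit (es @ [a]) f = ?c f" if "f \<in> set es" for f
      using that snoc.prems by (auto simp: new)
    show ?case
    proof (cases "e = a")
      case True
      have k: "k = (LEAST k. ?P k)" using snoc.prems True by (simp add: new)
      have "?P k" unfolding k
        by (rule LeastI_ex[of ?P]) (rule first_fit_free_color, simp add: dom_first_fit)
      moreover have "\<exists>f\<in>set (es @ [a]). f \<inter> e \<noteq> {} \<and> first_fit (es @ [a]) f = Some l"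
        if l: "1 \<le> l" "l < k" for l
      proof -
        have "\<not> ?P l" using l(2) unfolding k by (rule not_less_Least[of l ?P])
        then obtain f where "f \<in> set es" "f \<inter> a \<noteq> {}" "?c f = Some l"
          using l(1) by (auto simp: dom_first_fit)
        then show ?thesis using old True by auto
      qed
      ultimately show ?thesis by blast
    next
      case False
      then have "?c e = Some k" using snoc.prems by (simp add: new)
      then have "k \<ge> 1 \<and> (\<forall>l. 1 \<le> l \<and> l < k \<longrightarrow> (\<exists>f\<in>set es. f \<inter> e \<noteq> {} \<and> ?c f = Some l))"
        using snoc by simp
      then show ?thesis using old by (metis Un_iff set_append)
    qed
  qed
  then show "k \<ge> 1"
    and "\<And>l. \<lbrakk>1 \<le> l; l < k\<rbrakk> \<Longrightarrow> \<exists>f\<in>set es. f \<inter> e \<noteq> {} \<and> first_fit es f = Some l" by auto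
qed

lemma isomorphic_complete_graph:
  assumes "isomorphic F (complete_graph n)" "simple_graph F"
  shows "card (verts F) = n" and "\<And>e. \<lbrakk>e \<subseteq> verts F; card e = 2\<rbrakk> \<Longrightarrow> e \<in> edges F"
proof -
  from assms obtain f where f: "bij_betw f (verts F) {..<n}"
    and E: "{e. e \<subseteq> {..<n} \<and> card e = 2} = (\<lambda>e. f ` e) ` edges F"
    unfolding isomorphic_def complete_graph_def by auto
  show "card (verts F) = n" using bij_betw_same_card[OF f] by simp
  fix e assume e: "e \<subseteq> verts F" "card e = 2"
  have inj: "inj_on f (verts F)" using f by (simp add: bij_betw_def)
  have "f ` e \<subseteq> {..<n}" using e f by (auto simp: bij_betw_def)
  moreover have "card (f ` e) = 2" using e inj card_image inj_on_subset by metis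
  ultimately have "f ` e \<in> (\<lambda>e. f ` e) ` edges F" unfolding E[symmetric] by simp
  then obtain e' where e': "e' \<in> edges F" "f ` e = f ` e'" by auto
  then have "e' \<subseteq> verts F" using assms by (auto simp: simple_graph_def)
  then have "e = e'" using inj e' e by (simp add: inj_on_image_eq_iff)
  then show "e \<in> edges F" using e' by simp
qed

lemma choose_two_Suc: "Suc m choose 2 = (m choose 2) + m"
  by (simp add: numeral_2_eq_2)

lemma choose_three_Suc: "Suc m choose 3 = (m choose 2) + (m choose 3)"
  by (simp add: numeral_3_eq_3 numeral_2_eq_2)

text \<open>The parameter \<open>m\<close> bounds the number of vertices of the copy that miss
  \<open>k\<close>, uniformly for all \<open>k\<close> up to C(m+1,2). The final -1 pays for the
  single edge of color \<open>k\<close> that may cover two vertices of the copy.\<close>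

lemma card_color_class_ge:
  assumes pres: "presentation V es" and sub: "subgraph F (V, set es)"
    and iso: "isomorphic F (complete_graph n)" and rb: "inj_on (first_fit es) (edges F)"
    and k: "1 \<le> k" "k \<le> (Suc m choose 2)"
  shows "card {e \<in> set es. first_fit es e = Some k} \<ge> n - 1 - m"
proof -
  let ?c = "first_fit es" and ?W = "verts F"
  let ?E = "{e \<in> set es. ?c e = Some k}"
  have F: "simple_graph F" "edges F \<subseteq> set es" using sub by (auto simp: subgraph_def)
  have finW: "finite ?W" using F by (simp add: simple_graph_def)
  have dist: "distinct es" and es2: "\<And>e. e \<in> set es \<Longrightarrow> card e = 2"
    using pres by (auto simp: presentation_def simple_graph_def)
  note W = isomorphic_complete_graph[OF iso F(1)]
  \<comment> \<open>\<open>M\<close> collects the vertices of the copy that miss color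
    \<open>k\<close>.\<close>
  define M where "M = {v \<in> ?W. \<forall>e\<in>?E. v \<notin> e}"
  have MW: "M \<subseteq> ?W" and finM: "finite M" using finW by (auto simp: M_def)
  define P where "P = {e. e \<subseteq> M \<and> card e = 2}"
  have P: "P \<subseteq> edges F" using W(2) MW by (auto simp: P_def)
  \<comment> \<open>Color \<open>k\<close> is excluded because the ends of \<open>e\<close> miss it;
    a color above \<open>k\<close> would need an edge of color \<open>k\<close> meeting
    \<open>e\<close>, hence at a vertex of \<open>M\<close>.\<close>
  have col: "?c e \<in> Some ` {1..<k}" if "e \<in> P" for e
  proof -
    have e: "e \<in> set es" "e \<subseteq> M" "e \<noteq> {}" using that P F by (auto simp: P_def)
    then obtain l where l: "?c e = Some l" using dom_first_fit by fast
    have "l \<noteq> k" using e l by (auto simp: M_def)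
    moreover have "\<not> k < l" using first_fit_color(2)[OF dist l k(1)] e by (auto simp: M_def)
    ultimately show ?thesis using l first_fit_color(1)[OF dist l] by auto
  qed
  have "card P = card (?c ` P)" using rb P by (metis card_image inj_on_subset)
  also have "\<dots> \<le> card (Some ` {1..<k})" using col by (intro card_mono image_subsetI) simp_all
  finally have "card P \<le> k - 1" by (simp add: card_image)
  then have "card M choose 2 < (Suc m choose 2)" using n_subsets[OF finM, of 2] k by (simp add: P_def)
  then have cardM: "card M \<le> m" using binomial_right_mono[of "Suc m" "card M" 2] by linarith
  have one: "card {e \<in> ?E. e \<subseteq> ?W} \<le> Suc 0"
  proof (intro card_le_Suc0_iff_eq[THEN iffD2])
    show "\<forall>a\<in>{e \<in> ?E. e \<subseteq> ?W}. \<forall>b\<in>{e \<in> ?E. e \<subseteq> ?W}. a = b"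
    proof (intro ballI)
      fix a b assume "a \<in> {e \<in> ?E. e \<subseteq> ?W}" "b \<in> {e \<in> ?E. e \<subseteq> ?W}"
      then have "a \<in> edges F" "b \<in> edges F" "?c a = ?c b" using W(2) es2 by auto
      then show "a = b" using rb inj_onD by metis
    qed
  qed simp
  \<comment> \<open>Double counting: every vertex outside \<open>M\<close> lies on an edge of color
    \<open>k\<close>, and such an edge has at most one end in the copy unless it lies inside
    it.\<close>
  have "card (?W - M) \<le> card (\<Union>e\<in>?E. e \<inter> ?W)"
    using finW by (intro card_mono) (auto simp: M_def)
  also have "\<dots> \<le> (\<Sum>e\<in>?E. card (e \<inter> ?W))" by (rule card_UN_le) simp
  also have "\<dots> \<le> (\<Sum>e\<in>?E. 1 + (if e \<subseteq> ?W then 1 else 0))"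
  proof (rule sum_mono)
    fix e assume "e \<in> ?E"
    then have c: "card e = 2" "finite e" using es2 by (auto intro: card_ge_0_finite)
    show "card (e \<inter> ?W) \<le> 1 + (if e \<subseteq> ?W then 1 else 0)"
    proof (cases "e \<subseteq> ?W")
      case False
      then have "card (e \<inter> ?W) < card e" using c by (intro psubset_card_mono) auto
      then show ?thesis using c by simp
    qed (use c in \<open>simp add: Int_absorb2\<close>)
  qed
  also have "\<dots> = card ?E + card {e \<in> ?E. e \<subseteq> ?W}"
    unfolding sum.distrib by (simp add: sum.If_cases Int_def)
  finally have "card (?W - M) \<le> card ?E + 1" using one by linarith
  moreover have "card (?W - M) = n - card M" using W(1) MW finM by (simp add: card_Diff_subset)
  ultimately show ?thesis using cardM by linarith
qed

text \<open>Cuts the colors into consecutive blocks, the block of \<open>m\<close> having length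
  \<open>m\<close> and starting at C(m,2). On each block the bound of
  \<open>card_color_class_ge\<close> is the constant \<open>n - 1 - m\<close>.\<close>

lemma sum_lessThan_choose_two:
  "(\<Sum>k<n choose 2. f k) = (\<Sum>m<n. \<Sum>i<m. f ((m choose 2) + i))" for f :: "nat \<Rightarrow> nat"
proof (induction n)
  case (Suc n)
  have "(\<Sum>k<b + a. f k) = (\<Sum>k<b. f k) + (\<Sum>i<a. f (b + i))" for a b
    by (induction a) auto
  then show ?case using Suc by (simp add: choose_two_Suc)
qed (simp add: numeral_2_eq_2)

text \<open>Sort the 3-subsets of {0, ..., n-1} by their middle element \<open>m\<close>: there are
  \<open>m\<close> choices below it and \<open>n - 1 - m\<close> above.\<close>

lemma sum_diff_eq_choose_three: "(\<Sum>m<n. m * (n - 1 - m)) = n choose 3"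
proof (induction n)
  case (Suc n)
  have "(\<Sum>m<n. m * (n - m)) = (\<Sum>m<n. m * (n - 1 - m) + m)"
  proof (intro sum.cong refl)
    fix m assume "m \<in> {..<n}"
    then have "n - m = Suc (n - 1 - m)" by simp
    then show "m * (n - m) = m * (n - 1 - m) + m" by simp
  qed
  moreover have "(\<Sum>m<n. m) = n choose 2"
    by (induction n) (auto simp: choose_two_Suc)
  ultimately show ?case using Suc by (simp add: sum.distrib choose_three_Suc)
qed simp

lemma length_ge_choose_three:
  assumes pres: "presentation V es" and "has_rainbow_copy (first_fit es) (V, set es) (complete_graph n)"
  shows "n choose 3 \<le> length es"
proof -
  obtain F where F: "subgraph F (V, set es)" "isomorphic F (complete_graph n)"
    "inj_on (first_fit es) (edges F)"
    using assms by (auto simp: has_rainbow_copy_def)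
  \<comment> \<open>Shifted by one, since sums start at 0 but colors at 1.\<close>
  let ?E = "\<lambda>k. {e \<in> set es. first_fit es e = Some (Suc k)}"
  have "n choose 3 = (\<Sum>m<n. \<Sum>i<m. n - 1 - m)" using sum_diff_eq_choose_three[of n] by simp
  also have "\<dots> \<le> (\<Sum>m<n. \<Sum>i<m. card (?E ((m choose 2) + i)))"
    by (intro sum_mono card_color_class_ge[OF pres F]) (auto simp: choose_two_Suc)
  also have "\<dots> = (\<Sum>k<n choose 2. card (?E k))" by (simp add: sum_lessThan_choose_two)
  also have "\<dots> = card (\<Union>k<n choose 2. ?E k)" by (subst card_UN_disjoint) auto
  also have "\<dots> \<le> card (set es)" by (intro card_mono) auto
  also have "\<dots> \<le> length es" by (rule card_length)
  finally show ?thesis .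
qed

section \<open>Upper bound\<close>

text \<open>Edge number \<open>p\<close> presented at vertex \<open>j\<close>; it will get color \<open>p + 1\<close>. Vertices \<open>\<ge> n\<close> are leaves.\<close>

definition builder_edge :: "nat \<Rightarrow> nat \<Rightarrow> nat \<Rightarrow> nat set" where
  "builder_edge n j p =
     {j, if p < (j choose 2) then n + prod_encode (j, p) else p - (j choose 2)}"

text \<open>The length \<open>p\<close> is left free so that the coloring can be followed edge by
  edge within a block; the full block at \<open>j\<close> has length C(j+1,2).\<close>

definition builder_block :: "nat \<Rightarrow> nat \<Rightarrow> nat \<Rightarrow> nat set list" where
  "builder_block n j p = map (builder_edge n j) [0..<p]"

definition builder_edges :: "nat \<Rightarrow> nat \<Rightarrow> nat set list" where
  "builder_edges n j = concat (map (\<lambda>i. builder_block n i (Suc i choose 2)) [0..<j])"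

lemma builder_edges_Suc:
  "builder_edges n (Suc j) = builder_edges n j @ builder_block n j (Suc j choose 2)"
  by (simp add: builder_edges_def)

lemma length_builder_edges: "length (builder_edges n j) = Suc j choose 3"
  by (induction j)
    (auto simp: builder_edges_def builder_block_def choose_three_Suc)

text \<open>Injectivity of \<open>prod_encode\<close> gives each pendant edge its own leaf. Any
  other edge has both ends below \<open>n\<close>, and \<open>j\<close> is its larger end.\<close>

lemma builder_edge_inj:
  assumes "j < n" "j' < n" "p < (Suc j choose 2)" "p' < (Suc j' choose 2)"
    and "builder_edge n j p = builder_edge n j' p'"
  shows "j = j' \<and> p = p'"
  using assms by (auto simp: builder_edge_def doubleton_eq_iff choose_two_Suc split: if_splits)

text \<open>From p < C(j'+1,2) \<le> C(j,2) it follows that edge \<open>p\<close> at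
  \<open>j\<close> is pendant. Its leaf is new, and earlier blocks do not reach \<open>j\<close>. So
  color \<open>p + 1\<close> stays available for it.\<close>

lemma builder_edge_disjoint:
  assumes "j' < j" "j < n" "p < (Suc j' choose 2)"
  shows "builder_edge n j' p \<inter> builder_edge n j p = {}"
proof -
  have "p < (j choose 2)" using assms binomial_right_mono[of "Suc j'" j 2] by linarith
  then show ?thesis using assms by (auto simp: builder_edge_def choose_two_Suc)
qed

lemma first_fit_builder_block:
  assumes "j < n" "p \<le> (Suc j choose 2)"
    and "\<And>e k. first_fit (builder_edges n j) e = Some k \<longleftrightarrow>
      (\<exists>i q. i < j \<and> q < (Suc i choose 2) \<and> e = builder_edge n i q \<and> k = Suc q)"
  shows "first_fit (builder_edges n j @ builder_block n j p) e = Some k \<longleftrightarrow>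
      (\<exists>i q. (i < j \<and> q < (Suc i choose 2) \<or> i = j \<and> q < p) \<and> e = builder_edge n i q \<and> k = Suc q)"
  using assms(2)
proof (induction p arbitrary: e k)
  case 0
  then show ?case using assms(3) by (simp add: builder_block_def)
next
  case (Suc p)
  let ?c = "first_fit (builder_edges n j @ builder_block n j p)" and ?e = "builder_edge n j p"
  let ?P = "\<lambda>k. 1 \<le> k \<and> (\<forall>f\<in>dom ?c. f \<inter> ?e \<noteq> {} \<longrightarrow> ?c f \<noteq> Some k)"
  have IH: "?c e = Some k \<longleftrightarrow>
      (\<exists>i q. (i < j \<and> q < (Suc i choose 2) \<or> i = j \<and> q < p) \<and> e = builder_edge n i q \<and> k = Suc q)"
    for e k using Suc by simp
  have "(LEAST k. ?P k) = Suc p"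
  proof (rule Least_equality)
    \<comment> \<open>Only edges with index \<open>p\<close> carry this color so far. They belong to
      earlier vertices and are disjoint from the new edge.\<close>
    show "?P (Suc p)"
    proof (intro conjI ballI impI notI)
      fix f assume f: "f \<inter> ?e \<noteq> {}" "?c f = Some (Suc p)"
      then obtain i where "i < j" "p < (Suc i choose 2)" "f = builder_edge n i p"
        unfolding IH by auto
      then show False using builder_edge_disjoint assms(1) f(1) by blast
    qed simp
  next
    fix k assume k: "?P k"
    \<comment> \<open>The colors 1, ..., \<open>p\<close> are blocked by the previous edges of the
      block, which all contain \<open>j\<close>.\<close>
    show "Suc p \<le> k"
    proof (rule ccontr)
      assume "\<not> Suc p \<le> k"
      then obtain q where q: "k = Suc q" "q < p" using k by (cases k) auto
      then have "?c (builder_edge n j q) = Some k" unfolding IH by blast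
      moreover have "j \<in> builder_edge n j q \<inter> ?e" by (simp add: builder_edge_def)
      ultimately show False using k by blast
    qed
  qed
  then have eq: "first_fit (builder_edges n j @ builder_block n j (Suc p)) = ?c(?e \<mapsto> Suc p)"
    using first_fit_snoc[of "builder_edges n j @ builder_block n j p" ?e]
    by (simp add: first_fit_step_def builder_block_def)
  have fresh: "(i < j \<and> q < (Suc i choose 2) \<or> i = j \<and> q < p) \<Longrightarrow> builder_edge n i q \<noteq> ?e" for i q
    using builder_edge_inj[of i n j q p] assms(1) Suc.prems by auto
  show ?case
  proof (cases "e = ?e")
    case True
    then show ?thesis using fresh by (auto simp: eq less_Suc_eq)
  next
    case False
    then show ?thesis using IH[of e k] by (auto simp: eq less_Suc_eq)
  qed
qed

lemma first_fit_builder_edges: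
  assumes "j \<le> n"
  shows "first_fit (builder_edges n j) e = Some k \<longleftrightarrow>
      (\<exists>i q. i < j \<and> q < (Suc i choose 2) \<and> e = builder_edge n i q \<and> k = Suc q)"
  using assms
proof (induction j arbitrary: e k)
  case 0
  then show ?case by (simp add: builder_edges_def first_fit_def)
next
  case (Suc j)
  show ?case unfolding builder_edges_Suc
    using first_fit_builder_block[of j n "Suc j choose 2" e k] Suc
    by (auto simp: less_Suc_eq)
qed

lemma distinct_builder_edges:
  assumes "j \<le> n"
  shows "distinct (builder_edges n j)"
  using assms
proof (induction j)
  case (Suc j)
  have "distinct (builder_block n j (Suc j choose 2))"
    using builder_edge_inj[of j n j] Suc.prems
    by (auto simp: builder_block_def distinct_map inj_on_def)
  moreover have "set (builder_edges n j) \<inter> set (builder_block n j (Suc j choose 2)) = {}"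
  proof -
    have "i = j" if "i < j" "builder_edge n i q = builder_edge n j p"
      "q < (Suc i choose 2)" "p < (Suc j choose 2)" for i p q
      using that builder_edge_inj[of i n j q p] Suc.prems by auto
    then show ?thesis by (fastforce simp: builder_edges_def builder_block_def)
  qed
  ultimately show ?case using Suc by (simp add: builder_edges_Suc)
qed (simp add: builder_edges_def)

lemma presentation_builder_edges:
  "presentation (\<Union> (set (builder_edges n n))) (builder_edges n n)"
proof -
  have "card e = 2" "finite e" if "e \<in> set (builder_edges n n)" for e
    using that
    by (auto simp: builder_edges_def builder_block_def builder_edge_def choose_two_Suc card_insert_if)
  then show ?thesis
    using distinct_builder_edges[of n n] by (auto simp: presentation_def simple_graph_def)
qed

text \<open>The copy is \<open>complete_graph n\<close> itself: for i < j the edge {i, j} has color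
  C(j,2) + i + 1, which determines both \<open>i\<close> and \<open>j\<close>.\<close>

lemma rainbow_builder_edges:
  assumes "n \<ge> 2"
  shows "has_rainbow_copy (first_fit (builder_edges n n))
    (\<Union> (set (builder_edges n n)), set (builder_edges n n)) (complete_graph n)"
proof -
  let ?c = "first_fit (builder_edges n n)" and ?K = "complete_graph n"
  have K: "\<exists>i j. i < j \<and> j < n \<and> e = {i, j} \<and> ?c e = Some (Suc ((j choose 2) + i))"
    if e: "e \<in> edges ?K" for e
  proof -
    obtain x y where xy: "e = {x, y}" "x \<noteq> y" "x < n" "y < n"
      using e by (auto simp: complete_graph_def card_2_iff)
    define i j where "i = min x y" and "j = max x y"
    have ij: "i < j" "j < n" "e = {i, j}" using xy by (auto simp: i_def j_def min_def max_def)
    moreover from ij have "e = builder_edge n j ((j choose 2) + i)"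
      "(j choose 2) + i < (Suc j choose 2)"
      by (auto simp: builder_edge_def choose_two_Suc)
    ultimately have "?c e = Some (Suc ((j choose 2) + i))"
      unfolding first_fit_builder_edges[OF order_refl] by blast
    then show ?thesis using ij by blast
  qed
  have sub: "edges ?K \<subseteq> set (builder_edges n n)"
  proof
    fix e assume "e \<in> edges ?K"
    then have "e \<in> dom ?c" using K by blast
    then show "e \<in> set (builder_edges n n)" by (simp only: dom_first_fit)
  qed
  have "inj_on ?c (edges ?K)"
  proof (rule inj_onI)
    fix e e' assume "e \<in> edges ?K" "e' \<in> edges ?K" "?c e = ?c e'"
    with K[of e] K[of e'] obtain i j i' j' where *: "i < j" "e = {i, j}" "i' < j'" "e' = {i', j'}"
      "(j choose 2) + i = (j' choose 2) + i'" by auto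
    \<comment> \<open>If a < b, then C(a,2) + x < C(a+1,2) \<le> C(b,2), so the color ranges of
      different \<open>j\<close> do not overlap.\<close>
    have "\<not> a < b" if "(a choose 2) + x = (b choose 2) + y" "x < a" for a b x y :: nat
      using that binomial_right_mono[of "Suc a" b 2] by (auto simp: choose_two_Suc)
    then have "j = j'" using * by (metis nat_neq_iff)
    then show "e = e'" using * by simp
  qed
  moreover have "verts ?K \<subseteq> \<Union> (set (builder_edges n n))"
  proof
    fix v assume v: "v \<in> verts ?K"
    \<comment> \<open>A second vertex of the clique, available because n \<ge> 2; it puts
      \<open>v\<close> on a presented edge.\<close>
    define w where "w = (if v = 0 then 1 else 0 :: nat)"
    have "{v, w} \<in> edges ?K" using v assms by (auto simp: complete_graph_def w_def)
    then show "v \<in> \<Union> (set (builder_edges n n))" using sub by blast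
  qed
  moreover have "simple_graph ?K" by (simp add: simple_graph_def complete_graph_def)
  moreover have "isomorphic ?K ?K" unfolding isomorphic_def by (intro exI[of _ id]) auto
  ultimately show ?thesis using sub unfolding has_rainbow_copy_def subgraph_def
    by (intro exI[of _ ?K]) auto
qed

section \<open>Asymptotics\<close>

lemma AR_FF_complete_graph_bounds:
  assumes "n \<ge> 2"
  obtains t where "AR_FF (complete_graph n) = enat t" "n choose 3 \<le> t" "t \<le> Suc n choose 3"
proof -
  have "AR_FF (complete_graph n) \<le> enat (length (builder_edges n n))"
    unfolding AR_FF_def using presentation_builder_edges rainbow_builder_edges[OF assms]
    by (intro Inf_lower) blast
  moreover have "enat (n choose 3) \<le> AR_FF (complete_graph n)"
    unfolding AR_FF_def by (intro Inf_greatest) (auto intro: length_ge_choose_three)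
  ultimately show ?thesis using that
    by (cases "AR_FF (complete_graph n)") (auto simp: length_builder_edges)
qed

lemma real_choose_two: "real (n choose 2) = real n * (real n - 1) / 2"
  by (induction n) (auto simp: choose_two_Suc field_simps)

lemma real_choose_three: "real (n choose 3) = real n * (real n - 1) * (real n - 2) / 6"
  by (induction n) (auto simp: choose_three_Suc real_choose_two field_simps)

theorem theorem16:
  "\<exists>\<epsilon> :: nat \<Rightarrow> real. \<epsilon> \<longlonglongrightarrow> 0 \<and>
     (\<forall>n\<ge>2. ereal_of_enat (AR_FF (complete_graph n)) = ereal (real n ^ 3 / 6 * (1 + \<epsilon> n)))"
proof -
  have "\<forall>n\<ge>2. \<exists>t. AR_FF (complete_graph n) = enat t \<and> n choose 3 \<le> t \<and> t \<le> Suc n choose 3"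
    using AR_FF_complete_graph_bounds by metis
  then obtain t where t: "\<And>n. n \<ge> 2 \<Longrightarrow> AR_FF (complete_graph n) = enat (t n)"
    "\<And>n. n \<ge> 2 \<Longrightarrow> n choose 3 \<le> t n" "\<And>n. n \<ge> 2 \<Longrightarrow> t n \<le> Suc n choose 3"
    by metis
  \<comment> \<open>Obtained by solving the required equation for the error term.\<close>
  define \<epsilon> where "\<epsilon> n = 6 * real (t n) / real n ^ 3 - 1" for n
  have "\<epsilon> \<longlonglongrightarrow> 0"
  proof (rule tendsto_sandwich)
    \<comment> \<open>\<open>?l\<close> and \<open>?u\<close> are what C(n,3) and C(n+1,3) give in
      place of \<open>t n\<close>.\<close>
    let ?l = "\<lambda>n. real n * (real n - 1) * (real n - 2) / real n ^ 3 - 1"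
    let ?u = "\<lambda>n. (real n + 1) * real n * (real n - 1) / real n ^ 3 - 1"
    show "\<forall>\<^sub>F n in sequentially. ?l n \<le> \<epsilon> n"
      using eventually_ge_at_top[of 2]
    proof eventually_elim
      case (elim n)
      have "real (n choose 3) \<le> real (t n)" using t(2)[OF elim] by linarith
      then show ?case unfolding \<epsilon>_def
        by (intro diff_right_mono divide_right_mono) (auto simp: real_choose_three)
    qed
    show "\<forall>\<^sub>F n in sequentially. \<epsilon> n \<le> ?u n"
      using eventually_ge_at_top[of 2]
    proof eventually_elim
      case (elim n)
      have "real (t n) \<le> real (Suc n choose 3)" using t(3)[OF elim] by linarith
      then have "6 * real (t n) \<le> (real n + 1) * real n * (real n - 1)"
        unfolding real_choose_three by (simp add: algebra_simps)
      then show ?case unfolding \<epsilon>_def by (intro diff_right_mono divide_right_mono) auto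
    qed
    show "?l \<longlonglongrightarrow> 0" by real_asymp
    show "?u \<longlonglongrightarrow> 0" by real_asymp
  qed
  moreover have "ereal_of_enat (AR_FF (complete_graph n)) = ereal (real n ^ 3 / 6 * (1 + \<epsilon> n))"
    if "n \<ge> 2" for n
    using that by (simp add: t(1) \<epsilon>_def)
  ultimately show ?thesis by blast
qed

end
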